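(* Let $(A_n)_{n\ge 0}$ and $(B_n)_{n\ge 0}$ be binomial bimonoids in a $\mathbb{Q}_{\ge 0}$-linear symmetric monoidal category $(\mathsf{C},\otimes,I)$. Suppose that $A_1$ is isomorphic to $B_1$ in $\mathsf{C}$. Then $(A_n)$ and $(B_n)$ are isomorphic as binomial bimonoids.
   Context: Conventions. $f;g$ denotes composition in diagrammatic order (first $f$, then $g$); $\otimes$ binds tighter than $;$. Symmetric monoidal categories are treated as strict. $\gamma_{A,B}:A\otimes B\to B\otimes A$ is the symmetry. A $\mathbb{Q}_{\ge 0}$-linear symmetric monoidal category is a symmetric monoidal category in which every hom-set is a module over the commutative semiring $\mathbb{Q}_{\ge 0}$, and composition and $\otimes$ of morphisms are $\mathbb{Q}_{\ge 0}$-bilinear (in particular preserve $0$ in each variable). A binomial bimonoid is a family of objects $(A_n)_{n\ge 0}$ of $\mathsf{C}$ with maps $\nabla_{n,p}:A_n\otimes A_p\to A_{n+p}$, $\Delta_{n,p}:A_{n+p}\to A_n\otimes A_p$, $\eta:I\to A_0$, $\epsilon:A_0\to I$ such that for all $n,p,q,r\ge 0$: (i) $\eta\otimes\mathsf{id}_{A_n};\nabla_{0,n}=\mathsf{id}_{A_n}$; (ii) $\nabla_{n,p}\otimes\mathsf{id}_{A_q};\nabla_{n+p,q}=\mathsf{id}_{A_n}\otimes\nabla_{p,q};\nabla_{n,p+q}$; (iii) $\gamma_{A_n,A_p};\nabla_{p,n}=\nabla_{n,p}$; (iv) $\Delta_{0,n};\epsilon\otimes\mathsf{id}_{A_n}=\mathsf{id}_{A_n}$;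 (v) $\Delta_{n+p,q};\Delta_{n,p}\otimes\mathsf{id}_{A_q}=\Delta_{n,p+q};\mathsf{id}_{A_n}\otimes\Delta_{p,q}$; (vi) $\Delta_{n,p};\gamma_{A_n,A_p}=\Delta_{p,n}$; (vii) $\nabla_{0,0};\epsilon=\epsilon\otimes\epsilon$; (viii) $\eta;\Delta_{0,0}=\eta\otimes\eta$; (ix) $\eta;\epsilon=\mathsf{id}_I$; (x) whenever $n+p=q+r$, $\nabla_{n,p};\Delta_{q,r}=\sum\Delta_{a,b}\otimes\Delta_{c,d};\mathsf{id}_{A_a}\otimes\gamma_{A_b,A_c}\otimes\mathsf{id}_{A_d};\nabla_{a,c}\otimes\nabla_{b,d}$, sum over $a,b,c,d\ge 0$ with $a+b=n$, $c+d=p$, $a+c=q$, $b+d=r$; (xi) $\epsilon;\eta=\mathsf{id}_{A_0}$; (xii) $\Delta_{n,p};\nabla_{n,p}=\binom{n+p}{n}\mathsf{id}_{A_{n+p}}$. A morphism of binomial bimonoids $(A_n)\to(B_n)$ is a family $(f_n:A_n\to B_n)_{n\ge 0}$ with $\eta;f_0=\eta$, $f_0;\epsilon=\epsilon$, $f_n\otimes f_p;\nabla_{n,p}=\nabla_{n,p};f_{n+p}$ and $\Delta_{n,p};f_n\otimes f_p=f_{n+p};\Delta_{n,p}$ for all $n,p\ge 0$; composition and identities are componentwise, and isomorphism of binomial bimonoids means isomorphism in the resulting category. *)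

theory Defs
  imports Complex_Main "HOL-Algebra.FiniteProduct"
begin

record ('o, 'm) category =
  obj :: "'o set"
  arr :: "'m set"
  src :: "'m \<Rightarrow> 'o"
  tgt :: "'m \<Rightarrow> 'o"
  ident :: "'o \<Rightarrow> 'm" ("\<i>\<d>\<index>")
  seq :: "'m \<Rightarrow> 'm \<Rightarrow> 'm" (infixl "\<Zsemi>\<index>" 65)

record ('o, 'm) symmetric_monoidal_category = "('o, 'm) category" +
  tensor_obj :: "'o \<Rightarrow> 'o \<Rightarrow> 'o" (infixl "\<boxtimes>\<^sub>o\<index>" 70)
  tensor :: "'m \<Rightarrow> 'm \<Rightarrow> 'm" (infixl "\<boxtimes>\<index>" 70)
  unit_obj :: "'o" ("\<I>\<index>")
  symm :: "'o \<Rightarrow> 'o \<Rightarrow> 'm" ("\<gamma>\<index>")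

record ('o, 'm) linear_symmetric_monoidal_category = "('o, 'm) symmetric_monoidal_category" +
  zero_arr :: "'o \<Rightarrow> 'o \<Rightarrow> 'm"
  add_arr :: "'m \<Rightarrow> 'm \<Rightarrow> 'm" (infixl "\<boxplus>\<index>" 60)
  scale_arr :: "rat \<Rightarrow> 'm \<Rightarrow> 'm" (infixr "\<star>\<index>" 75)

definition homset :: "('o, 'm, 'z) category_scheme \<Rightarrow> 'o \<Rightarrow> 'o \<Rightarrow> 'm set" where
  "homset C X Y = {f \<in> arr C. src C f = X \<and> tgt C f = Y}"

text \<open>Composition is written in diagrammatic order.\<close>

locale category =
  fixes C :: "('o, 'm, 'z) category_scheme" (structure)
  assumes src_obj: "f \<in> arr C \<Longrightarrow> src C f \<in> obj C"
    and tgt_obj: "f \<in> arr C \<Longrightarrow> tgt C f \<in> obj C"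
    and ident_homset: "X \<in> obj C \<Longrightarrow> \<i>\<d> X \<in> homset C X X"
    and seq_homset: "\<lbrakk>f \<in> homset C X Y; g \<in> homset C Y Z\<rbrakk> \<Longrightarrow> f \<Zsemi> g \<in> homset C X Z"
    and ident_seq: "f \<in> homset C X Y \<Longrightarrow> \<i>\<d> X \<Zsemi> f = f"
    and seq_ident: "f \<in> homset C X Y \<Longrightarrow> f \<Zsemi> \<i>\<d> Y = f"
    and seq_assoc: "\<lbrakk>f \<in> homset C W X; g \<in> homset C X Y; h \<in> homset C Y Z\<rbrakk>
      \<Longrightarrow> (f \<Zsemi> g) \<Zsemi> h = f \<Zsemi> (g \<Zsemi> h)"

definition isomorphic :: "('o, 'm, 'z) category_scheme \<Rightarrow> 'o \<Rightarrow> 'o \<Rightarrow> bool" where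
  "isomorphic C X Y \<longleftrightarrow> X \<in> obj C \<and> Y \<in> obj C \<and>
     (\<exists>f \<in> homset C X Y. \<exists>g \<in> homset C Y X.
        f \<Zsemi>\<^bsub>C\<^esub> g = \<i>\<d>\<^bsub>C\<^esub> X \<and> g \<Zsemi>\<^bsub>C\<^esub> f = \<i>\<d>\<^bsub>C\<^esub> Y)"

text \<open>The monoidal structure is strict: associativity and unitality of the tensor product
  are equations between objects and between morphisms. The second hexagon and the triviality of
  the symmetry at the unit object follow from the axioms below.\<close>

locale strict_symmetric_monoidal_category = category C
  for C :: "('o, 'm, 'z) symmetric_monoidal_category_scheme" (structure) +
  assumes unit_obj: "\<I> \<in> obj C"
    and tensor_obj: "\<lbrakk>X \<in> obj C; Y \<in> obj C\<rbrakk> \<Longrightarrow> X \<boxtimes>\<^sub>o Y \<in> obj C"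
    and tensor_obj_assoc: "\<lbrakk>X \<in> obj C; Y \<in> obj C; Z \<in> obj C\<rbrakk>
      \<Longrightarrow> (X \<boxtimes>\<^sub>o Y) \<boxtimes>\<^sub>o Z = X \<boxtimes>\<^sub>o (Y \<boxtimes>\<^sub>o Z)"
    and unit_tensor_obj: "X \<in> obj C \<Longrightarrow> \<I> \<boxtimes>\<^sub>o X = X"
    and tensor_obj_unit: "X \<in> obj C \<Longrightarrow> X \<boxtimes>\<^sub>o \<I> = X"
    and tensor_homset: "\<lbrakk>f \<in> homset C X Y; g \<in> homset C X' Y'\<rbrakk>
      \<Longrightarrow> f \<boxtimes> g \<in> homset C (X \<boxtimes>\<^sub>o X') (Y \<boxtimes>\<^sub>o Y')"
    and tensor_ident: "\<lbrakk>X \<in> obj C; Y \<in> obj C\<rbrakk> \<Longrightarrow> \<i>\<d> X \<boxtimes> \<i>\<d> Y = \<i>\<d> (X \<boxtimes>\<^sub>o Y)"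
    and interchange: "\<lbrakk>f \<in> homset C X Y; g \<in> homset C Y Z; f' \<in> homset C X' Y'; g' \<in> homset C Y' Z'\<rbrakk>
      \<Longrightarrow> (f \<Zsemi> g) \<boxtimes> (f' \<Zsemi> g') = (f \<boxtimes> f') \<Zsemi> (g \<boxtimes> g')"
    and tensor_assoc: "\<lbrakk>f \<in> arr C; g \<in> arr C; h \<in> arr C\<rbrakk> \<Longrightarrow> (f \<boxtimes> g) \<boxtimes> h = f \<boxtimes> (g \<boxtimes> h)"
    and unit_tensor: "f \<in> arr C \<Longrightarrow> \<i>\<d> \<I> \<boxtimes> f = f"
    and tensor_unit: "f \<in> arr C \<Longrightarrow> f \<boxtimes> \<i>\<d> \<I> = f"
    and symm_homset: "\<lbrakk>X \<in> obj C; Y \<in> obj C\<rbrakk> \<Longrightarrow> \<gamma> X Y \<in> homset C (X \<boxtimes>\<^sub>o Y) (Y \<boxtimes>\<^sub>o X)"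
    and symm_natural: "\<lbrakk>f \<in> homset C X Y; g \<in> homset C X' Y'\<rbrakk>
      \<Longrightarrow> (f \<boxtimes> g) \<Zsemi> \<gamma> Y Y' = \<gamma> X X' \<Zsemi> (g \<boxtimes> f)"
    and symm_symm: "\<lbrakk>X \<in> obj C; Y \<in> obj C\<rbrakk> \<Longrightarrow> \<gamma> X Y \<Zsemi> \<gamma> Y X = \<i>\<d> (X \<boxtimes>\<^sub>o Y)"
    and hexagon: "\<lbrakk>X \<in> obj C; Y \<in> obj C; Z \<in> obj C\<rbrakk>
      \<Longrightarrow> \<gamma> X (Y \<boxtimes>\<^sub>o Z) = (\<gamma> X Y \<boxtimes> \<i>\<d> Z) \<Zsemi> (\<i>\<d> Y \<boxtimes> \<gamma> X Z)"

text \<open>The additive monoid of a hom-set, as a monoid record of HOL-Algebra; thus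
  \<open>finprod (hom_monoid C X Y)\<close> is the finite sum of morphisms.\<close>

definition hom_monoid ::
    "('o, 'm, 'z) linear_symmetric_monoidal_category_scheme \<Rightarrow> 'o \<Rightarrow> 'o \<Rightarrow> 'm monoid" where
  "hom_monoid C X Y = \<lparr>carrier = homset C X Y, mult = add_arr C, one = zero_arr C X Y\<rparr>"

text \<open>The semiring of scalars consists of the nonnegative elements of \<open>rat\<close>; scaling by negative
  rationals is unconstrained.\<close>

locale nonneg_rat_linear_smc = strict_symmetric_monoidal_category C
  for C :: "('o, 'm, 'z) linear_symmetric_monoidal_category_scheme" (structure) +
  assumes hom_comm_monoid: "\<lbrakk>X \<in> obj C; Y \<in> obj C\<rbrakk> \<Longrightarrow> comm_monoid (hom_monoid C X Y)"
    and scale_homset: "\<lbrakk>0 \<le> s; f \<in> homset C X Y\<rbrakk> \<Longrightarrow> s \<star> f \<in> homset C X Y"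
    and scale_add: "\<lbrakk>0 \<le> s; f \<in> homset C X Y; g \<in> homset C X Y\<rbrakk>
      \<Longrightarrow> s \<star> (f \<boxplus> g) = s \<star> f \<boxplus> s \<star> g"
    and add_scale: "\<lbrakk>0 \<le> s; 0 \<le> t; f \<in> arr C\<rbrakk> \<Longrightarrow> (s + t) \<star> f = s \<star> f \<boxplus> t \<star> f"
    and scale_scale: "\<lbrakk>0 \<le> s; 0 \<le> t; f \<in> arr C\<rbrakk> \<Longrightarrow> (s * t) \<star> f = s \<star> (t \<star> f)"
    and one_scale: "f \<in> arr C \<Longrightarrow> 1 \<star> f = f"
    and zero_scale: "f \<in> homset C X Y \<Longrightarrow> 0 \<star> f = zero_arr C X Y"
    and scale_zero: "\<lbrakk>0 \<le> s; X \<in> obj C; Y \<in> obj C\<rbrakk> \<Longrightarrow> s \<star> zero_arr C X Y = zero_arr C X Y"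
    and add_seq: "\<lbrakk>f \<in> homset C X Y; f' \<in> homset C X Y; g \<in> homset C Y Z\<rbrakk>
      \<Longrightarrow> (f \<boxplus> f') \<Zsemi> g = (f \<Zsemi> g) \<boxplus> (f' \<Zsemi> g)"
    and seq_add: "\<lbrakk>f \<in> homset C X Y; g \<in> homset C Y Z; g' \<in> homset C Y Z\<rbrakk>
      \<Longrightarrow> f \<Zsemi> (g \<boxplus> g') = (f \<Zsemi> g) \<boxplus> (f \<Zsemi> g')"
    and scale_seq: "\<lbrakk>0 \<le> s; f \<in> homset C X Y; g \<in> homset C Y Z\<rbrakk>
      \<Longrightarrow> (s \<star> f) \<Zsemi> g = s \<star> (f \<Zsemi> g)"
    and seq_scale: "\<lbrakk>0 \<le> s; f \<in> homset C X Y; g \<in> homset C Y Z\<rbrakk>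
      \<Longrightarrow> f \<Zsemi> (s \<star> g) = s \<star> (f \<Zsemi> g)"
    and add_tensor: "\<lbrakk>f \<in> homset C X Y; f' \<in> homset C X Y; g \<in> homset C X' Y'\<rbrakk>
      \<Longrightarrow> (f \<boxplus> f') \<boxtimes> g = (f \<boxtimes> g) \<boxplus> (f' \<boxtimes> g)"
    and tensor_add: "\<lbrakk>f \<in> homset C X Y; g \<in> homset C X' Y'; g' \<in> homset C X' Y'\<rbrakk>
      \<Longrightarrow> f \<boxtimes> (g \<boxplus> g') = (f \<boxtimes> g) \<boxplus> (f \<boxtimes> g')"
    and scale_tensor: "\<lbrakk>0 \<le> s; f \<in> homset C X Y; g \<in> homset C X' Y'\<rbrakk>
      \<Longrightarrow> (s \<star> f) \<boxtimes> g = s \<star> (f \<boxtimes> g)"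
    and tensor_scale: "\<lbrakk>0 \<le> s; f \<in> homset C X Y; g \<in> homset C X' Y'\<rbrakk>
      \<Longrightarrow> f \<boxtimes> (s \<star> g) = s \<star> (f \<boxtimes> g)"
begin

lemma zero_homset: "\<lbrakk>X \<in> obj C; Y \<in> obj C\<rbrakk> \<Longrightarrow> zero_arr C X Y \<in> homset C X Y"
  using comm_monoid.axioms(1)[OF hom_comm_monoid, THEN monoid.one_closed]
  by (simp add: hom_monoid_def)

lemma zero_seq:
  assumes "X \<in> obj C" "g \<in> homset C Y Z"
  shows "zero_arr C X Y \<Zsemi> g = zero_arr C X Z"
proof -
  have z: "zero_arr C X Y \<in> homset C X Y"
    using assms src_obj by (intro zero_homset) (auto simp: homset_def)
  show ?thesis
    using scale_seq[of 0, OF _ z assms(2)] zero_scale[OF z] zero_scale[OF seq_homset[OF z assms(2)]]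
    by simp
qed

lemma seq_zero:
  assumes "f \<in> homset C X Y" "Z \<in> obj C"
  shows "f \<Zsemi> zero_arr C Y Z = zero_arr C X Z"
proof -
  have z: "zero_arr C Y Z \<in> homset C Y Z"
    using assms tgt_obj by (intro zero_homset) (auto simp: homset_def)
  show ?thesis
    using seq_scale[of 0, OF _ assms(1) z] zero_scale[OF z] zero_scale[OF seq_homset[OF assms(1) z]]
    by simp
qed

lemma zero_tensor:
  assumes "X \<in> obj C" "Y \<in> obj C" "g \<in> homset C X' Y'"
  shows "zero_arr C X Y \<boxtimes> g = zero_arr C (X \<boxtimes>\<^sub>o X') (Y \<boxtimes>\<^sub>o Y')"
proof -
  note z = zero_homset[OF assms(1,2)]
  show ?thesis
    using scale_tensor[of 0, OF _ z assms(3)] zero_scale[OF z]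
      zero_scale[OF tensor_homset[OF z assms(3)]]
    by simp
qed

lemma tensor_zero:
  assumes "f \<in> homset C X Y" "X' \<in> obj C" "Y' \<in> obj C"
  shows "f \<boxtimes> zero_arr C X' Y' = zero_arr C (X \<boxtimes>\<^sub>o X') (Y \<boxtimes>\<^sub>o Y')"
proof -
  note z = zero_homset[OF assms(2,3)]
  show ?thesis
    using tensor_scale[of 0, OF _ assms(1) z] zero_scale[OF z]
      zero_scale[OF tensor_homset[OF assms(1) z]]
    by simp
qed

end

record ('o, 'm) graded_bimonoid =
  grade :: "nat \<Rightarrow> 'o"
  nabla :: "nat \<Rightarrow> nat \<Rightarrow> 'm"
  Delta :: "nat \<Rightarrow> nat \<Rightarrow> 'm"
  eta :: "'m"
  eps :: "'m"

locale binomial_bimonoid = nonneg_rat_linear_smc C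
  for C :: "('o, 'm, 'z) linear_symmetric_monoidal_category_scheme" (structure)
    and A :: "('o, 'm) graded_bimonoid" +
  assumes grade_obj: "grade A n \<in> obj C"
    and nabla_homset: "nabla A n p \<in> homset C (grade A n \<boxtimes>\<^sub>o grade A p) (grade A (n + p))"
    and Delta_homset: "Delta A n p \<in> homset C (grade A (n + p)) (grade A n \<boxtimes>\<^sub>o grade A p)"
    and eta_homset: "eta A \<in> homset C \<I> (grade A 0)"
    and eps_homset: "eps A \<in> homset C (grade A 0) \<I>"
    and nabla_unit: "eta A \<boxtimes> \<i>\<d> (grade A n) \<Zsemi> nabla A 0 n = \<i>\<d> (grade A n)"
    and nabla_assoc: "nabla A n p \<boxtimes> \<i>\<d> (grade A q) \<Zsemi> nabla A (n + p) q
      = \<i>\<d> (grade A n) \<boxtimes> nabla A p q \<Zsemi> nabla A n (p + q)"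
    and nabla_comm: "\<gamma> (grade A n) (grade A p) \<Zsemi> nabla A p n = nabla A n p"
    and Delta_counit: "Delta A 0 n \<Zsemi> eps A \<boxtimes> \<i>\<d> (grade A n) = \<i>\<d> (grade A n)"
    and Delta_coassoc: "Delta A (n + p) q \<Zsemi> Delta A n p \<boxtimes> \<i>\<d> (grade A q)
      = Delta A n (p + q) \<Zsemi> \<i>\<d> (grade A n) \<boxtimes> Delta A p q"
    and Delta_cocomm: "Delta A n p \<Zsemi> \<gamma> (grade A n) (grade A p) = Delta A p n"
    and nabla_eps: "nabla A 0 0 \<Zsemi> eps A = eps A \<boxtimes> eps A"
    and eta_Delta: "eta A \<Zsemi> Delta A 0 0 = eta A \<boxtimes> eta A"
    and eta_eps: "eta A \<Zsemi> eps A = \<i>\<d> \<I>"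
    and nabla_Delta: "n + p = q + r \<Longrightarrow> nabla A n p \<Zsemi> Delta A q r
      = finprod (hom_monoid C (grade A n \<boxtimes>\<^sub>o grade A p) (grade A q \<boxtimes>\<^sub>o grade A r))
          (\<lambda>(a, b, c, d).
             Delta A a b \<boxtimes> Delta A c d
             \<Zsemi> \<i>\<d> (grade A a) \<boxtimes> \<gamma> (grade A b) (grade A c) \<boxtimes> \<i>\<d> (grade A d)
             \<Zsemi> nabla A a c \<boxtimes> nabla A b d)
          {(a, b, c, d). a + b = n \<and> c + d = p \<and> a + c = q \<and> b + d = r}"
    and eps_eta: "eps A \<Zsemi> eta A = \<i>\<d> (grade A 0)"
    and Delta_nabla: "Delta A n p \<Zsemi> nabla A n p
      = of_nat ((n + p) choose n) \<star> \<i>\<d> (grade A (n + p))"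

definition binomial_bimonoid_hom ::
    "('o, 'm, 'z) linear_symmetric_monoidal_category_scheme \<Rightarrow>
     ('o, 'm) graded_bimonoid \<Rightarrow> ('o, 'm) graded_bimonoid \<Rightarrow> (nat \<Rightarrow> 'm) \<Rightarrow> bool" where
  "binomial_bimonoid_hom C A B f \<longleftrightarrow>
     (\<forall>n. f n \<in> homset C (grade A n) (grade B n)) \<and>
     eta A \<Zsemi>\<^bsub>C\<^esub> f 0 = eta B \<and>
     f 0 \<Zsemi>\<^bsub>C\<^esub> eps B = eps A \<and>
     (\<forall>n p. f n \<boxtimes>\<^bsub>C\<^esub> f p \<Zsemi>\<^bsub>C\<^esub> nabla B n p = nabla A n p \<Zsemi>\<^bsub>C\<^esub> f (n + p)) \<and>
     (\<forall>n p. Delta A n p \<Zsemi>\<^bsub>C\<^esub> f n \<boxtimes>\<^bsub>C\<^esub> f p = f (n + p) \<Zsemi>\<^bsub>C\<^esub> Delta B n p)"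

text \<open>A morphism of this category is a family tagged with its source and target.\<close>

definition binomial_bimonoids ::
    "('o, 'm, 'z) linear_symmetric_monoidal_category_scheme \<Rightarrow>
     (('o, 'm) graded_bimonoid,
      ('o, 'm) graded_bimonoid \<times> ('o, 'm) graded_bimonoid \<times> (nat \<Rightarrow> 'm)) category" where
  "binomial_bimonoids C = \<lparr>
     obj = {A. binomial_bimonoid C A},
     arr = {(A, B, f). binomial_bimonoid C A \<and> binomial_bimonoid C B \<and> binomial_bimonoid_hom C A B f},
     src = (\<lambda>(A, B, f). A),
     tgt = (\<lambda>(A, B, f). B),
     ident = (\<lambda>A. (A, A, \<lambda>n. \<i>\<d>\<^bsub>C\<^esub> (grade A n))),
     seq = (\<lambda>(A, B, f) (B', D, g). (A, D, \<lambda>n. f n \<Zsemi>\<^bsub>C\<^esub> g n))\<rparr>"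

lemma (in nonneg_rat_linear_smc) binomial_bimonoid_hom_ident:
  assumes A: "binomial_bimonoid C A"
  shows "binomial_bimonoid_hom C A A (\<lambda>n. \<i>\<d> (grade A n))"
proof -
  interpret A: binomial_bimonoid C A by (rule A)
  show ?thesis
    unfolding binomial_bimonoid_hom_def
    using ident_homset[OF A.grade_obj]
      seq_ident[OF A.eta_homset] ident_seq[OF A.eps_homset]
      ident_seq[OF A.nabla_homset] seq_ident[OF A.nabla_homset]
      ident_seq[OF A.Delta_homset] seq_ident[OF A.Delta_homset]
    by (simp add: tensor_ident A.grade_obj)
qed

lemma (in nonneg_rat_linear_smc) binomial_bimonoid_hom_seq:
  assumes "binomial_bimonoid C A" "binomial_bimonoid C B" "binomial_bimonoid C D"
    and "binomial_bimonoid_hom C A B f" "binomial_bimonoid_hom C B D g"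
  shows "binomial_bimonoid_hom C A D (\<lambda>n. f n \<Zsemi> g n)"
proof -
  interpret A: binomial_bimonoid C A by fact
  interpret B: binomial_bimonoid C B by fact
  interpret D: binomial_bimonoid C D by fact
  have f: "f n \<in> homset C (grade A n) (grade B n)"
    and g: "g n \<in> homset C (grade B n) (grade D n)" for n
    using assms(4,5) by (auto simp: binomial_bimonoid_hom_def)
  have f_eta: "eta A \<Zsemi> f 0 = eta B" and g_eta: "eta B \<Zsemi> g 0 = eta D"
    and f_eps: "f 0 \<Zsemi> eps B = eps A" and g_eps: "g 0 \<Zsemi> eps D = eps B"
    using assms(4,5) by (auto simp: binomial_bimonoid_hom_def)
  have f_nabla: "f n \<boxtimes> f p \<Zsemi> nabla B n p = nabla A n p \<Zsemi> f (n + p)"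
    and g_nabla: "g n \<boxtimes> g p \<Zsemi> nabla D n p = nabla B n p \<Zsemi> g (n + p)"
    and f_Delta: "Delta A n p \<Zsemi> f n \<boxtimes> f p = f (n + p) \<Zsemi> Delta B n p"
    and g_Delta: "Delta B n p \<Zsemi> g n \<boxtimes> g p = g (n + p) \<Zsemi> Delta D n p" for n p
    using assms(4,5) by (auto simp: binomial_bimonoid_hom_def)
  note ff = tensor_homset[OF f f] and gg = tensor_homset[OF g g]
  have inter: "(f n \<Zsemi> g n) \<boxtimes> (f p \<Zsemi> g p) = f n \<boxtimes> f p \<Zsemi> g n \<boxtimes> g p" for n p
    by (rule interchange[OF f g f g])
  have "(f n \<Zsemi> g n) \<boxtimes> (f p \<Zsemi> g p) \<Zsemi> nabla D n p = nabla A n p \<Zsemi> (f (n + p) \<Zsemi> g (n + p))"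
    for n p
    unfolding inter
    by (simp add: seq_assoc[OF ff gg D.nabla_homset] g_nabla
        seq_assoc[OF ff B.nabla_homset g, symmetric] f_nabla
        seq_assoc[OF A.nabla_homset f g])
  moreover have "Delta A n p \<Zsemi> (f n \<Zsemi> g n) \<boxtimes> (f p \<Zsemi> g p) = f (n + p) \<Zsemi> g (n + p) \<Zsemi> Delta D n p"
    for n p
    unfolding inter
    by (simp add: seq_assoc[OF A.Delta_homset ff gg, symmetric] f_Delta
        seq_assoc[OF f B.Delta_homset gg] g_Delta
        seq_assoc[OF f g D.Delta_homset])
  moreover have "eta A \<Zsemi> (f 0 \<Zsemi> g 0) = eta D"
    by (simp add: seq_assoc[OF A.eta_homset f g, symmetric] f_eta g_eta)
  moreover have "f 0 \<Zsemi> g 0 \<Zsemi> eps D = eps A"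
    by (simp add: seq_assoc[OF f g D.eps_homset] f_eps g_eps)
  ultimately show ?thesis
    by (simp add: binomial_bimonoid_hom_def seq_homset[OF f g])
qed

lemma (in nonneg_rat_linear_smc) category_binomial_bimonoids:
  "category (binomial_bimonoids C)"
proof (standard, goal_cases)
  case (3 X)
  then show ?case
    by (auto simp: binomial_bimonoids_def homset_def binomial_bimonoid_hom_ident)
next
  case (4 f X Y g Z)
  then show ?case
    by (auto simp: binomial_bimonoids_def homset_def intro: binomial_bimonoid_hom_seq)
next
  case (5 f X Y)
  then show ?case
    by (auto simp: binomial_bimonoids_def homset_def binomial_bimonoid_hom_def
        intro!: ext ident_seq)
next
  case (6 f X Y)
  then show ?case
    by (auto simp: binomial_bimonoids_def homset_def binomial_bimonoid_hom_def
        intro!: ext seq_ident)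
next
  case (7 f W X g Y h Z)
  then show ?case
    by (auto simp: binomial_bimonoids_def homset_def binomial_bimonoid_hom_def
        intro!: ext seq_assoc)
qed (auto simp: binomial_bimonoids_def)

end

theory Submission
  imports Defs
begin

text \<open>
  Every morphism \<open>u : A\<^sub>1 \<rightarrow> B\<^sub>1\<close> extends to a morphism of binomial bimonoids, namely
  \<open>f\<^sub>0 = \<epsilon>;\<eta>\<close> and \<open>(n+1) f\<^bsub>n+1\<^esub> = \<Delta>\<^bsub>n,1\<^esub>; f\<^sub>n \<otimes> u; \<nabla>\<^bsub>n,1\<^esub>\<close>.
  Axiom (xii) makes every \<open>\<nabla>\<^bsub>n,p\<^esub>\<close> a split epimorphism, so a morphism of binomial bimonoids is
  determined by its component of degree one; hence the extensions of mutually inverse \<open>u\<close> and \<open>v\<close>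
  are mutually inverse.

  The crux is \<open>f\<^sub>n \<otimes> u; \<nabla>\<^bsub>n,1\<^esub> = \<nabla>\<^bsub>n,1\<^esub>; f\<^bsub>n+1\<^esub>\<close>, proved by induction: by axiom (x),
  \<open>\<nabla>\<^bsub>n,1\<^esub>;\<Delta>\<^bsub>n,1\<^esub>\<close> is the identity plus \<open>\<Delta>\<^bsub>n-1,1\<^esub> \<otimes> id; id \<otimes> \<gamma>; \<nabla>\<^bsub>n-1,1\<^esub> \<otimes> id\<close>. By the
  induction hypothesis and commutativity of \<open>\<nabla>\<close>, the second summand composed with
  \<open>f\<^sub>n \<otimes> u; \<nabla>\<^bsub>n,1\<^esub>\<close> gives \<open>n\<close> times that morphism. Multiplicativity in all degrees and
  compatibility with \<open>\<Delta>\<close> follow by cancelling split epimorphisms.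
\<close>

section \<open>Typing of composites through \<open>arr\<close>, \<open>src\<close> and
  \<open>tgt\<close>\<close>

context category
begin

lemma homset_iff: "f \<in> homset C X Y \<longleftrightarrow> f \<in> arr C \<and> src C f = X \<and> tgt C f = Y"
  by (simp add: homset_def)

lemma seq_typing:
  assumes "f \<in> arr C" "g \<in> arr C" "tgt C f = src C g"
  shows "f \<Zsemi> g \<in> arr C" "src C (f \<Zsemi> g) = src C f" "tgt C (f \<Zsemi> g) = tgt C g"
  using seq_homset[of f "src C f" "tgt C f" g "tgt C g"] assms by (auto simp: homset_def)

lemma ident_typing:
  assumes "X \<in> obj C"
  shows "\<i>\<d> X \<in> arr C" "src C (\<i>\<d> X) = X" "tgt C (\<i>\<d> X) = X"
  using ident_homset[OF assms] by (auto simp: homset_def)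

lemma seq_assoc_arr:
  assumes "f \<in> arr C" "g \<in> arr C" "h \<in> arr C" "tgt C f = src C g" "tgt C g = src C h"
  shows "f \<Zsemi> g \<Zsemi> h = f \<Zsemi> (g \<Zsemi> h)"
  using seq_assoc[of f "src C f" "tgt C f" g "tgt C g" h "tgt C h"] assms
  by (auto simp: homset_def)

lemma ident_seq_arr: "\<lbrakk>f \<in> arr C; src C f = X\<rbrakk> \<Longrightarrow> \<i>\<d> X \<Zsemi> f = f"
  using ident_seq[of f X "tgt C f"] by (auto simp: homset_def)

lemma seq_ident_arr: "\<lbrakk>f \<in> arr C; tgt C f = Y\<rbrakk> \<Longrightarrow> f \<Zsemi> \<i>\<d> Y = f"
  using seq_ident[of f "src C f" Y] by (auto simp: homset_def)

text \<open>Together these decide composability by rewriting and nest composites to the right. The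
  axioms on \<open>homset\<close> involve a middle object that the simplifier would have to
  guess.\<close>

lemmas arr_simps = homset_iff src_obj tgt_obj seq_typing ident_typing
  seq_assoc_arr ident_seq_arr seq_ident_arr

end

section \<open>Strict tensor calculus and the symmetry\<close>

context strict_symmetric_monoidal_category
begin

lemma tensor_typing:
  assumes "f \<in> arr C" "g \<in> arr C"
  shows "f \<boxtimes> g \<in> arr C" "src C (f \<boxtimes> g) = src C f \<boxtimes>\<^sub>o src C g"
    "tgt C (f \<boxtimes> g) = tgt C f \<boxtimes>\<^sub>o tgt C g"
  using tensor_homset[of f "src C f" "tgt C f" g "src C g" "tgt C g"] assms
  by (auto simp: homset_def)

lemma symm_typing:
  assumes "X \<in> obj C" "Y \<in> obj C"
  shows "\<gamma> X Y \<in> arr C" "src C (\<gamma> X Y) = X \<boxtimes>\<^sub>o Y" "tgt C (\<gamma> X Y) = Y \<boxtimes>\<^sub>o X"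
  using symm_homset[OF assms] by (auto simp: homset_def)

lemmas smc_simps = arr_simps tensor_typing symm_typing unit_obj tensor_obj
  tensor_obj_assoc unit_tensor_obj tensor_obj_unit tensor_ident tensor_assoc unit_tensor tensor_unit

text \<open>Interchange oriented so that two layers merge into one. It stays outside
  \<open>smc_simps\<close> because right-nesting of tensor products can obscure which factors are to
  be paired; most uses instantiate it explicitly.\<close>

lemma tensor_seq_tensor:
  assumes "f \<in> arr C" "g \<in> arr C" "f' \<in> arr C" "g' \<in> arr C"
    "tgt C f = src C g" "tgt C f' = src C g'"
  shows "(f \<boxtimes> f') \<Zsemi> (g \<boxtimes> g') = (f \<Zsemi> g) \<boxtimes> (f' \<Zsemi> g')"
  using interchange[of f "src C f" "tgt C f" g "tgt C g" f' "src C f'" "tgt C f'" g' "tgt C g'"] assms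
  by (auto simp: homset_def)

text \<open>The hexagon with two unit objects makes \<open>\<gamma> X \<I>\<close> idempotent, and
  an invertible idempotent is an identity.\<close>

lemma symm_unit:
  assumes "X \<in> obj C"
  shows "\<gamma> X \<I> = \<i>\<d> X" "\<gamma> \<I> X = \<i>\<d> X"
proof -
  have g: "\<gamma> X \<I> \<in> homset C X X" "\<gamma> \<I> X \<in> homset C X X"
    using assms by (auto simp: smc_simps)
  have "\<gamma> X \<I> \<Zsemi> \<gamma> X \<I> = \<gamma> X (\<I> \<boxtimes>\<^sub>o \<I>)"
    using g assms using hexagon[of X \<I> \<I>] tensor_unit[of "\<gamma> X \<I>"] unit_tensor[of "\<gamma> X \<I>"] unit_obj
    by (simp only: homset_iff)
  then have idem: "\<gamma> X \<I> \<Zsemi> \<gamma> X \<I> = \<gamma> X \<I>"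
    by (simp add: unit_tensor_obj unit_obj)
  have inv: "\<gamma> X \<I> \<Zsemi> \<gamma> \<I> X = \<i>\<d> X"
    using symm_symm[OF assms unit_obj] assms by (simp add: tensor_obj_unit)
  have "\<gamma> X \<I> \<Zsemi> (\<gamma> X \<I> \<Zsemi> \<gamma> \<I> X) = \<gamma> X \<I> \<Zsemi> \<gamma> \<I> X"
    unfolding seq_assoc[OF g(1,1,2), symmetric] idem ..
  then show *: "\<gamma> X \<I> = \<i>\<d> X"
    unfolding inv seq_ident[OF g(1)] .
  show "\<gamma> \<I> X = \<i>\<d> X"
    using inv unfolding * ident_seq[OF g(2)] .
qed

text \<open>Strictness regroups the four factors so that only the middle two cross; there naturality
  of the symmetry applies. This is the middle layer of the bialgebra axiom.\<close>

lemma symm_middle_natural: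
  assumes "f \<in> homset C X X'" "g \<in> homset C Y Y'" "h \<in> homset C Z Z'" "k \<in> homset C W W'"
  shows "(\<i>\<d> X \<boxtimes> \<gamma> Y Z \<boxtimes> \<i>\<d> W) \<Zsemi> ((f \<boxtimes> h) \<boxtimes> (g \<boxtimes> k))
    = ((f \<boxtimes> g) \<boxtimes> (h \<boxtimes> k)) \<Zsemi> (\<i>\<d> X' \<boxtimes> \<gamma> Y' Z' \<boxtimes> \<i>\<d> W')"
proof -
  have o: "X \<in> obj C" "Y \<in> obj C" "Z \<in> obj C" "W \<in> obj C"
    "X' \<in> obj C" "Y' \<in> obj C" "Z' \<in> obj C" "W' \<in> obj C"
    using assms src_obj tgt_obj by (auto simp: homset_def)
  have "(\<i>\<d> X \<boxtimes> \<gamma> Y Z \<boxtimes> \<i>\<d> W) \<Zsemi> (f \<boxtimes> (h \<boxtimes> g) \<boxtimes> k) = f \<boxtimes> (\<gamma> Y Z \<Zsemi> h \<boxtimes> g) \<boxtimes> k"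
    using assms o tensor_seq_tensor[of "\<gamma> Y Z" "h \<boxtimes> g" "\<i>\<d> W" k]
    by (simp add: smc_simps tensor_seq_tensor)
  also have "\<dots> = f \<boxtimes> (g \<boxtimes> h \<Zsemi> \<gamma> Y' Z') \<boxtimes> k"
    using symm_natural[OF assms(2,3)] by simp
  also have "\<dots> = (f \<boxtimes> (g \<boxtimes> h) \<boxtimes> k) \<Zsemi> (\<i>\<d> X' \<boxtimes> \<gamma> Y' Z' \<boxtimes> \<i>\<d> W')"
    using assms o tensor_seq_tensor[of "g \<boxtimes> h" "\<gamma> Y' Z'" k "\<i>\<d> W'"]
    by (simp add: smc_simps tensor_seq_tensor)
  finally show ?thesis
    using assms by (simp add: smc_simps)
qed

end

section \<open>Finite sums of morphisms and cancellation of scalars\<close>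

context nonneg_rat_linear_smc
begin

lemma finite_sum_closed:
  assumes "F \<in> S \<rightarrow> homset C X Y" "X \<in> obj C" "Y \<in> obj C"
  shows "finprod (hom_monoid C X Y) F S \<in> homset C X Y"
  using comm_monoid.finprod_closed[OF hom_comm_monoid[OF assms(2,3)]] assms(1)
  by (simp add: hom_monoid_def)

text \<open>Induction over the index set extends additivity to finite sums; the empty sum is covered
  by \<open>zero_seq\<close>.\<close>

lemma sum_seq:
  assumes "finite S" "F \<in> S \<rightarrow> homset C X Y" "g \<in> homset C Y Z" "X \<in> obj C"
  shows "finprod (hom_monoid C X Y) F S \<Zsemi> g = finprod (hom_monoid C X Z) (\<lambda>i. F i \<Zsemi> g) S"
  using assms(1,2)
proof (induction S rule: finite_induct)
  have o: "Y \<in> obj C" "Z \<in> obj C"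
    using assms(3) src_obj tgt_obj by (auto simp: homset_def)
  note M = hom_comm_monoid[OF assms(4) o(1)] and N = hom_comm_monoid[OF assms(4) o(2)]
  {
    case empty
    show ?case
      unfolding comm_monoid.finprod_empty[OF M] comm_monoid.finprod_empty[OF N]
      using zero_seq[OF assms(4,3)] by (simp add: hom_monoid_def)
  next
    case (insert i S)
    have F: "F i \<in> homset C X Y" "F \<in> S \<rightarrow> homset C X Y"
      using insert.prems by auto
    have G: "F i \<Zsemi> g \<in> homset C X Z" "(\<lambda>i. F i \<Zsemi> g) \<in> S \<rightarrow> homset C X Z"
      using F seq_homset[OF _ assms(3)] by auto
    have "finprod (hom_monoid C X Y) F (insert i S) = F i \<boxplus> finprod (hom_monoid C X Y) F S"
      using comm_monoid.finprod_insert[OF M insert.hyps, of F] F by (simp add: hom_monoid_def)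
    moreover have "finprod (hom_monoid C X Z) (\<lambda>i. F i \<Zsemi> g) (insert i S)
        = F i \<Zsemi> g \<boxplus> finprod (hom_monoid C X Z) (\<lambda>i. F i \<Zsemi> g) S"
      using comm_monoid.finprod_insert[OF N insert.hyps, of "\<lambda>i. F i \<Zsemi> g"] G
      by (simp add: hom_monoid_def)
    ultimately show ?case
      using add_seq[OF F(1) finite_sum_closed[OF F(2) assms(4) o(1)] assms(3)] insert.IH[OF F(2)]
      by simp
  }
qed

lemma seq_sum:
  assumes "finite S" "F \<in> S \<rightarrow> homset C Y Z" "g \<in> homset C X Y" "Z \<in> obj C"
  shows "g \<Zsemi> finprod (hom_monoid C Y Z) F S = finprod (hom_monoid C X Z) (\<lambda>i. g \<Zsemi> F i) S"
  using assms(1,2)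
proof (induction S rule: finite_induct)
  have o: "X \<in> obj C" "Y \<in> obj C"
    using assms(3) src_obj tgt_obj by (auto simp: homset_def)
  note M = hom_comm_monoid[OF o(2) assms(4)] and N = hom_comm_monoid[OF o(1) assms(4)]
  {
    case empty
    show ?case
      unfolding comm_monoid.finprod_empty[OF M] comm_monoid.finprod_empty[OF N]
      using seq_zero[OF assms(3,4)] by (simp add: hom_monoid_def)
  next
    case (insert i S)
    have F: "F i \<in> homset C Y Z" "F \<in> S \<rightarrow> homset C Y Z"
      using insert.prems by auto
    have G: "g \<Zsemi> F i \<in> homset C X Z" "(\<lambda>i. g \<Zsemi> F i) \<in> S \<rightarrow> homset C X Z"
      using F seq_homset[OF assms(3)] by auto
    have "finprod (hom_monoid C Y Z) F (insert i S) = F i \<boxplus> finprod (hom_monoid C Y Z) F S"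
      using comm_monoid.finprod_insert[OF M insert.hyps, of F] F by (simp add: hom_monoid_def)
    moreover have "finprod (hom_monoid C X Z) (\<lambda>i. g \<Zsemi> F i) (insert i S)
        = g \<Zsemi> F i \<boxplus> finprod (hom_monoid C X Z) (\<lambda>i. g \<Zsemi> F i) S"
      using comm_monoid.finprod_insert[OF N insert.hyps, of "\<lambda>i. g \<Zsemi> F i"] G
      by (simp add: hom_monoid_def)
    ultimately show ?case
      using seq_add[OF assms(3) F(1) finite_sum_closed[OF F(2) o(2) assms(4)]] insert.IH[OF F(2)]
      by simp
  }
qed

text \<open>A positive rational has an inverse that is again nonnegative, so it cancels although
  morphisms cannot be subtracted.\<close>

lemma scale_cancel:
  assumes "s \<star> f = s \<star> g" "0 < s" "f \<in> arr C" "g \<in> arr C"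
  shows "f = g"
  using scale_scale[of "1 / s" s f] scale_scale[of "1 / s" s g] assms
  by (simp add: one_scale)

end

section \<open>Degree zero and cancellation in a binomial bimonoid\<close>

context binomial_bimonoid
begin

lemma structure_typing:
  "nabla A n p \<in> arr C" "src C (nabla A n p) = grade A n \<boxtimes>\<^sub>o grade A p"
  "tgt C (nabla A n p) = grade A (n + p)"
  "Delta A n p \<in> arr C" "src C (Delta A n p) = grade A (n + p)"
  "tgt C (Delta A n p) = grade A n \<boxtimes>\<^sub>o grade A p"
  "eta A \<in> arr C" "src C (eta A) = \<I>" "tgt C (eta A) = grade A 0"
  "eps A \<in> arr C" "src C (eps A) = grade A 0" "tgt C (eps A) = \<I>"
  using nabla_homset[of n p] Delta_homset[of n p] eta_homset eps_homset
  by (auto simp: homset_def)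

lemmas bimonoid_simps = smc_simps grade_obj structure_typing

text \<open>Since \<open>eps A\<close> and \<open>eta A\<close> are mutually inverse,
  \<open>grade A 0\<close> is a copy of the unit object. Inserting
  \<open>eps A \<Zsemi> eta A\<close> on the left factor lets the unit law remove the
  multiplication.\<close>

lemma nabla_0_left: "nabla A 0 n = eps A \<boxtimes> \<i>\<d> (grade A n)"
proof -
  have "nabla A 0 n = (eps A \<Zsemi> eta A) \<boxtimes> \<i>\<d> (grade A n) \<Zsemi> nabla A 0 n"
    unfolding eps_eta by (simp add: bimonoid_simps)
  also have "\<dots> = eps A \<boxtimes> \<i>\<d> (grade A n) \<Zsemi> (eta A \<boxtimes> \<i>\<d> (grade A n) \<Zsemi> nabla A 0 n)"
    using tensor_seq_tensor[of "eps A" "eta A" "\<i>\<d> (grade A n)" "\<i>\<d> (grade A n)"]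
    by (simp add: bimonoid_simps flip: seq_assoc_arr)
  finally show ?thesis
    unfolding nabla_unit by (simp add: bimonoid_simps)
qed

text \<open>Commutativity carries the left version over; the symmetry slides past
  \<open>eps A\<close> to the unit object, where it is trivial.\<close>

lemma nabla_0_right: "nabla A n 0 = \<i>\<d> (grade A n) \<boxtimes> eps A"
  using symm_natural[OF ident_homset[OF grade_obj[of n]] eps_homset]
  by (simp add: bimonoid_simps nabla_0_left symm_unit flip: nabla_comm[of n 0])

lemma Delta_0_left: "Delta A 0 n = eta A \<boxtimes> \<i>\<d> (grade A n)"
proof -
  have "Delta A 0 n = Delta A 0 n \<Zsemi> (eps A \<Zsemi> eta A) \<boxtimes> \<i>\<d> (grade A n)"
    unfolding eps_eta by (simp add: bimonoid_simps)
  also have "\<dots> = Delta A 0 n \<Zsemi> eps A \<boxtimes> \<i>\<d> (grade A n) \<Zsemi> eta A \<boxtimes> \<i>\<d> (grade A n)"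
    using tensor_seq_tensor[of "eps A" "eta A" "\<i>\<d> (grade A n)" "\<i>\<d> (grade A n)"]
    by (simp add: bimonoid_simps)
  finally show ?thesis
    unfolding Delta_counit by (simp add: bimonoid_simps)
qed

lemma Delta_0_right: "Delta A n 0 = \<i>\<d> (grade A n) \<boxtimes> eta A"
  using symm_natural[OF eta_homset ident_homset[OF grade_obj[of n]]]
  by (simp add: bimonoid_simps Delta_0_left symm_unit flip: Delta_cocomm[of 0 n])

text \<open>The isomorphism of \<open>grade A 0\<close> with the unit object transports the
  triviality of the symmetry from there.\<close>

lemma symm_grade_0: "\<gamma> (grade A 0) (grade A 0) = \<i>\<d> (grade A 0 \<boxtimes>\<^sub>o grade A 0)"
proof -
  let ?X = "grade A 0"
  have e: "\<gamma> ?X ?X \<Zsemi> eps A \<boxtimes> eps A = eps A \<boxtimes> eps A"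
    using symm_natural[OF eps_homset eps_homset, symmetric] by (simp add: bimonoid_simps symm_unit)
  have "\<gamma> ?X ?X = \<gamma> ?X ?X \<Zsemi> (eps A \<Zsemi> eta A) \<boxtimes> (eps A \<Zsemi> eta A)"
    unfolding eps_eta by (simp add: bimonoid_simps)
  also have "\<dots> = \<gamma> ?X ?X \<Zsemi> eps A \<boxtimes> eps A \<Zsemi> eta A \<boxtimes> eta A"
    using tensor_seq_tensor[of "eps A" "eta A" "eps A" "eta A", symmetric]
    by (simp add: bimonoid_simps flip: seq_assoc_arr)
  also have "\<dots> = eps A \<boxtimes> eps A \<Zsemi> eta A \<boxtimes> eta A"
    using e by simp
  also have "\<dots> = \<i>\<d> ?X \<boxtimes> \<i>\<d> ?X"
    unfolding eps_eta[symmetric] by (rule tensor_seq_tensor) (simp_all add: bimonoid_simps)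
  finally show ?thesis
    by (simp add: bimonoid_simps)
qed

text \<open>The reason is that \<open>Delta\<close> followed by \<open>nabla\<close> is a positive integer multiple of the identity
  and positive integers act invertibly.\<close>

lemma nabla_cancel:
  assumes "nabla A n p \<Zsemi> f = nabla A n p \<Zsemi> g"
    and "f \<in> homset C (grade A (n + p)) Y" "g \<in> homset C (grade A (n + p)) Y"
  shows "f = g"
proof -
  have "of_nat ((n + p) choose n) \<star> h = Delta A n p \<Zsemi> (nabla A n p \<Zsemi> h)"
    if "h \<in> homset C (grade A (n + p)) Y" for h
    using that scale_seq[OF _ ident_homset[OF grade_obj] that, of "of_nat ((n + p) choose n)"]
      seq_assoc[OF Delta_homset nabla_homset that]
    by (simp add: ident_seq Delta_nabla)
  then have "of_nat ((n + p) choose n) \<star> f = of_nat ((n + p) choose n) \<star> g"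
    using assms by simp
  then show ?thesis
    by (rule scale_cancel) (use assms(2,3) in \<open>auto simp: homset_def\<close>)
qed

text \<open>Tensoring with \<open>\<i>\<d> X\<close> is linear, so \<open>Delta\<close> followed by
  \<open>nabla\<close> in the second factor is still a positive multiple of the identity. This form
  serves inductions on the second degree.\<close>

lemma tensor_nabla_cancel:
  assumes eq: "\<i>\<d> X \<boxtimes> nabla A n p \<Zsemi> f = \<i>\<d> X \<boxtimes> nabla A n p \<Zsemi> g"
    and X: "X \<in> obj C"
    and f: "f \<in> homset C (X \<boxtimes>\<^sub>o grade A (n + p)) Y" and g: "g \<in> homset C (X \<boxtimes>\<^sub>o grade A (n + p)) Y"
  shows "f = g"
proof -
  have "of_nat ((n + p) choose n) \<star> h = \<i>\<d> X \<boxtimes> Delta A n p \<Zsemi> (\<i>\<d> X \<boxtimes> nabla A n p \<Zsemi> h)"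
    if h: "h \<in> homset C (X \<boxtimes>\<^sub>o grade A (n + p)) Y" for h
  proof -
    let ?s = "of_nat ((n + p) choose n) :: rat"
    have "\<i>\<d> X \<boxtimes> Delta A n p \<Zsemi> (\<i>\<d> X \<boxtimes> nabla A n p \<Zsemi> h)
        = \<i>\<d> X \<boxtimes> (Delta A n p \<Zsemi> nabla A n p) \<Zsemi> h"
      using h X tensor_seq_tensor[of "\<i>\<d> X" "\<i>\<d> X" "Delta A n p" "nabla A n p"]
      by (simp add: bimonoid_simps flip: seq_assoc_arr)
    also have "\<dots> = ?s \<star> (\<i>\<d> X \<boxtimes> \<i>\<d> (grade A (n + p))) \<Zsemi> h"
      unfolding Delta_nabla
      using tensor_scale[OF _ ident_homset[OF X] ident_homset[OF grade_obj], of ?s "n + p"] by simp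
    also have "\<dots> = ?s \<star> h"
      using h X scale_seq[of ?s "\<i>\<d> (X \<boxtimes>\<^sub>o grade A (n + p))" _ _ h Y]
      by (simp add: bimonoid_simps)
    finally show ?thesis by simp
  qed
  then have "of_nat ((n + p) choose n) \<star> f = of_nat ((n + p) choose n) \<star> g"
    using eq f g by simp
  then show ?thesis
    by (rule scale_cancel) (use f g in \<open>auto simp: homset_def\<close>)
qed

section \<open>Summands of the bialgebra axiom\<close>

lemma finite_exchange_indices:
  "finite {(a, b, c, d). a + b = n \<and> c + d = p \<and> a + c = q \<and> b + d = (r :: nat)}"
  by (rule finite_subset[of _ "{..n} \<times> {..n} \<times> {..p} \<times> {..p}"]) auto

text \<open>The four degrees form a matrix with rows \<open>a b\<close> and \<open>c d\<close>: row
  sums are the degrees of the source, column sums those of the target.\<close>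

definition exchange :: "nat \<Rightarrow> nat \<Rightarrow> nat \<Rightarrow> nat \<Rightarrow> 'm" where
  "exchange a b c d = Delta A a b \<boxtimes> Delta A c d
     \<Zsemi> \<i>\<d> (grade A a) \<boxtimes> \<gamma> (grade A b) (grade A c) \<boxtimes> \<i>\<d> (grade A d)
     \<Zsemi> nabla A a c \<boxtimes> nabla A b d"

lemma exchange_homset:
  "exchange a b c d \<in> homset C (grade A (a + b) \<boxtimes>\<^sub>o grade A (c + d))
     (grade A (a + c) \<boxtimes>\<^sub>o grade A (b + d))"
  by (simp add: exchange_def bimonoid_simps)

lemma nabla_Delta_exchange:
  assumes "n + p = q + r"
  shows "nabla A n p \<Zsemi> Delta A q r
    = finprod (hom_monoid C (grade A n \<boxtimes>\<^sub>o grade A p) (grade A q \<boxtimes>\<^sub>o grade A r))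
        (\<lambda>(a, b, c, d). exchange a b c d)
        {(a, b, c, d). a + b = n \<and> c + d = p \<and> a + c = q \<and> b + d = r}"
  unfolding nabla_Delta[OF assms] exchange_def ..

text \<open>The symmetry acts on two copies of \<open>grade A 0\<close>, hence trivially, and both
  remaining composites of \<open>Delta\<close> and \<open>nabla\<close> have binomial coefficient
  1.\<close>

lemma exchange_0: "exchange n 0 0 p = \<i>\<d> (grade A n \<boxtimes>\<^sub>o grade A p)"
proof -
  have "exchange n 0 0 p = Delta A n 0 \<boxtimes> Delta A 0 p \<Zsemi> nabla A n 0 \<boxtimes> nabla A 0 p"
    by (simp add: exchange_def symm_grade_0 bimonoid_simps)
  also have "\<dots> = (Delta A n 0 \<Zsemi> nabla A n 0) \<boxtimes> (Delta A 0 p \<Zsemi> nabla A 0 p)"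
    by (rule tensor_seq_tensor) (simp_all add: bimonoid_simps)
  finally show ?thesis
    using one_scale[of "\<i>\<d> (grade A n)"] one_scale[of "\<i>\<d> (grade A p)"]
    by (simp add: Delta_nabla bimonoid_simps)
qed

text \<open>The corner of degree zero is created by \<open>eta A\<close> and deleted by
  \<open>eps A\<close>; these cancel, leaving a swap of two factors of degree one.\<close>

lemma exchange_1: "exchange n 1 1 0 = Delta A n 1 \<boxtimes> \<i>\<d> (grade A 1)
    \<Zsemi> \<i>\<d> (grade A n) \<boxtimes> \<gamma> (grade A 1) (grade A 1)
    \<Zsemi> nabla A n 1 \<boxtimes> \<i>\<d> (grade A 1)"
proof -
  let ?D = "Delta A n 1 \<boxtimes> \<i>\<d> (grade A 1)"
    and ?G = "\<i>\<d> (grade A n) \<boxtimes> \<gamma> (grade A 1) (grade A 1)"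
    and ?N = "nabla A n 1 \<boxtimes> \<i>\<d> (grade A 1)"
  have "exchange n 1 1 0 = ?D \<boxtimes> eta A \<Zsemi> ?G \<boxtimes> \<i>\<d> (grade A 0) \<Zsemi> ?N \<boxtimes> eps A"
    unfolding exchange_def Delta_0_right nabla_0_right
    by (simp add: bimonoid_simps del: One_nat_def)
  also have "\<dots> = (?D \<Zsemi> ?G \<Zsemi> ?N) \<boxtimes> (eta A \<Zsemi> \<i>\<d> (grade A 0) \<Zsemi> eps A)"
    using tensor_seq_tensor[of ?D ?G "eta A" "\<i>\<d> (grade A 0)"]
      tensor_seq_tensor[of "?D \<Zsemi> ?G" ?N "eta A \<Zsemi> \<i>\<d> (grade A 0)" "eps A"]
    by (simp add: bimonoid_simps del: One_nat_def)
  also have "\<dots> = ?D \<Zsemi> ?G \<Zsemi> ?N"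
    by (simp add: bimonoid_simps eta_eps del: One_nat_def)
  finally show ?thesis .
qed

text \<open>In degree zero there is nothing to swap: the two maps delete and reinsert a copy of the
  unit object.\<close>

lemma nabla_Delta_0: "nabla A 0 1 \<Zsemi> Delta A 0 1 = \<i>\<d> (grade A 0 \<boxtimes>\<^sub>o grade A 1)"
proof -
  have "nabla A 0 1 \<Zsemi> Delta A 0 1 = (eps A \<Zsemi> eta A) \<boxtimes> (\<i>\<d> (grade A 1) \<Zsemi> \<i>\<d> (grade A 1))"
    unfolding nabla_0_left Delta_0_left
    by (rule tensor_seq_tensor) (simp_all add: bimonoid_simps)
  then show ?thesis
    unfolding eps_eta by (simp add: bimonoid_simps)
qed

lemma nabla_Delta_Suc:
  "nabla A (n + 1) 1 \<Zsemi> Delta A (n + 1) 1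
    = \<i>\<d> (grade A (n + 1) \<boxtimes>\<^sub>o grade A 1) \<boxplus> exchange n 1 1 0"
proof -
  let ?X = "grade A (n + 1) \<boxtimes>\<^sub>o grade A 1"
  have X: "?X \<in> obj C"
    by (simp add: bimonoid_simps)
  \<comment> \<open>The second row and the second column both sum to 1, so \<open>d\<close> is 0 or
    1 and determines the other entries.\<close>
  have idx: "{(a, b, c, d). a + b = n + 1 \<and> c + d = 1 \<and> a + c = n + 1 \<and> b + d = (1 :: nat)}
      = {(n + 1, 0, 0, 1), (n, 1, 1, 0)}"
    by auto
  have e: "exchange (n + 1) 0 0 1 \<in> homset C ?X ?X" "exchange n 1 1 0 \<in> homset C ?X ?X"
    using exchange_homset[of "n + 1" 0 0 1] exchange_homset[of n 1 1 0] by auto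
  note M = hom_comm_monoid[OF X X]
  have "nabla A (n + 1) 1 \<Zsemi> Delta A (n + 1) 1
    = finprod (hom_monoid C ?X ?X) (\<lambda>(a, b, c, d). exchange a b c d)
        {(n + 1, 0, 0, 1), (n, 1, 1, 0)}"
    unfolding nabla_Delta_exchange[OF refl] idx ..
  also have "\<dots> = exchange (n + 1) 0 0 1 \<boxplus> exchange n 1 1 0"
    using e comm_monoid.finprod_insert[OF M, of "{(n, 1, 1, 0)}" "(n + 1, 0, 0, 1)"
        "\<lambda>(a, b, c, d). exchange a b c d"]
      comm_monoid.finprod_insert[OF M, of "{}" "(n, 1, 1, 0)" "\<lambda>(a, b, c, d). exchange a b c d"]
      comm_monoid.finprod_empty[OF M, of "\<lambda>(a, b, c, d). exchange a b c d"]
      monoid.r_one[OF comm_monoid.axioms(1)[OF M], of "exchange n 1 1 0"]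
    by (simp add: hom_monoid_def)
  finally show ?thesis
    unfolding exchange_0 .
qed

text \<open>Reassociation brings the two factors of equal degree together, and commutativity of
  \<open>nabla A p p\<close> absorbs the symmetry.\<close>

lemma nabla_swap:
  "\<i>\<d> (grade A n) \<boxtimes> \<gamma> (grade A p) (grade A p) \<Zsemi> nabla A n p \<boxtimes> \<i>\<d> (grade A p) \<Zsemi> nabla A (n + p) p
    = nabla A n p \<boxtimes> \<i>\<d> (grade A p) \<Zsemi> nabla A (n + p) p"
proof -
  have "\<i>\<d> (grade A n) \<boxtimes> \<gamma> (grade A p) (grade A p)
      \<Zsemi> (\<i>\<d> (grade A n) \<boxtimes> nabla A p p \<Zsemi> nabla A n (p + p))
    = \<i>\<d> (grade A n) \<boxtimes> (\<gamma> (grade A p) (grade A p) \<Zsemi> nabla A p p) \<Zsemi> nabla A n (p + p)"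
    using tensor_seq_tensor[of "\<i>\<d> (grade A n)" "\<i>\<d> (grade A n)"
        "\<gamma> (grade A p) (grade A p)" "nabla A p p"]
    by (simp add: bimonoid_simps flip: seq_assoc_arr)
  then show ?thesis
    using nabla_assoc[of n p p] by (simp add: bimonoid_simps nabla_comm)
qed

end

section \<open>Compatibility of graded maps with the two structures\<close>

locale binomial_bimonoid_pair =
  A: binomial_bimonoid C A + B: binomial_bimonoid C B
  for C :: "('o, 'm, 'z) linear_symmetric_monoidal_category_scheme" (structure)
    and A B :: "('o, 'm) graded_bimonoid"
begin

lemmas pair_simps = A.bimonoid_simps B.structure_typing B.grade_obj

text \<open>The maps pass through the three layers one at a time, starting from the
  \<open>nabla\<close> layer. Compatibility with \<open>Delta\<close> is assumed only for the two
  splittings that occur, so the lemma can be used inside an induction on the total degree.\<close>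

lemma exchange_natural:
  assumes f: "\<And>n. f n \<in> homset C (grade A n) (grade B n)"
    and nabla: "\<And>n p. f n \<boxtimes> f p \<Zsemi> nabla B n p = nabla A n p \<Zsemi> f (n + p)"
    and Delta: "Delta A a b \<Zsemi> f a \<boxtimes> f b = f (a + b) \<Zsemi> Delta B a b"
      "Delta A c d \<Zsemi> f c \<boxtimes> f d = f (c + d) \<Zsemi> Delta B c d"
  shows "A.exchange a b c d \<Zsemi> f (a + c) \<boxtimes> f (b + d) = f (a + b) \<boxtimes> f (c + d) \<Zsemi> B.exchange a b c d"
proof -
  have t: "f n \<in> arr C" "src C (f n) = grade A n" "tgt C (f n) = grade B n" for n
    using f[of n] by (auto simp: homset_def)
  let ?DA = "Delta A a b \<boxtimes> Delta A c d" and ?DB = "Delta B a b \<boxtimes> Delta B c d"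
    and ?GA = "\<i>\<d> (grade A a) \<boxtimes> \<gamma> (grade A b) (grade A c) \<boxtimes> \<i>\<d> (grade A d)"
    and ?GB = "\<i>\<d> (grade B a) \<boxtimes> \<gamma> (grade B b) (grade B c) \<boxtimes> \<i>\<d> (grade B d)"
    and ?NA = "nabla A a c \<boxtimes> nabla A b d" and ?NB = "nabla B a c \<boxtimes> nabla B b d"
    and ?P = "f (a + b) \<boxtimes> f (c + d)" and ?Q = "f (a + c) \<boxtimes> f (b + d)"
    and ?R = "(f a \<boxtimes> f b) \<boxtimes> (f c \<boxtimes> f d)" and ?S = "(f a \<boxtimes> f c) \<boxtimes> (f b \<boxtimes> f d)"
  have N: "?NA \<Zsemi> ?Q = ?S \<Zsemi> ?NB"
  proof -
    have "?NA \<Zsemi> ?Q = (nabla A a c \<Zsemi> f (a + c)) \<boxtimes> (nabla A b d \<Zsemi> f (b + d))"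
      by (rule A.tensor_seq_tensor) (simp_all add: pair_simps t)
    also have "\<dots> = ?S \<Zsemi> ?NB"
      unfolding nabla[symmetric]
      by (rule A.tensor_seq_tensor[symmetric]) (simp_all add: pair_simps t)
    finally show ?thesis .
  qed
  have G: "?GA \<Zsemi> ?S = ?R \<Zsemi> ?GB"
    by (rule A.symm_middle_natural[OF f f f f])
  have D: "?DA \<Zsemi> ?R = ?P \<Zsemi> ?DB"
  proof -
    have "?DA \<Zsemi> ?R = (Delta A a b \<Zsemi> f a \<boxtimes> f b) \<boxtimes> (Delta A c d \<Zsemi> f c \<boxtimes> f d)"
      by (rule A.tensor_seq_tensor) (simp_all add: pair_simps t)
    also have "\<dots> = ?P \<Zsemi> ?DB"
      unfolding Delta
      by (rule A.tensor_seq_tensor[symmetric]) (simp_all add: pair_simps t)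
    finally show ?thesis .
  qed
  have "?DA \<Zsemi> ?GA \<Zsemi> ?NA \<Zsemi> ?Q = ?DA \<Zsemi> ?GA \<Zsemi> (?NA \<Zsemi> ?Q)"
    by (rule A.seq_assoc_arr) (simp_all add: pair_simps t)
  also have "\<dots> = ?DA \<Zsemi> (?GA \<Zsemi> ?S) \<Zsemi> ?NB"
    unfolding N by (simp add: pair_simps t)
  also have "\<dots> = ?DA \<Zsemi> ?R \<Zsemi> (?GB \<Zsemi> ?NB)"
    unfolding G by (simp add: pair_simps t)
  also have "\<dots> = ?P \<Zsemi> (?DB \<Zsemi> ?GB \<Zsemi> ?NB)"
    unfolding D by (simp add: pair_simps t)
  finally show ?thesis
    unfolding A.exchange_def B.exchange_def .
qed

text \<open>Precompose with the split epimorphism \<open>nabla m 1\<close>, where \<open>m + 1 = n + p\<close>; the bialgebra axiom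
  then reduces the claim to degrees \<open>m\<close> and \<open>1\<close>, both smaller than \<open>n + p\<close> unless one of \<open>n\<close>, \<open>p\<close>
  is zero.\<close>

lemma multiplicative_imp_comultiplicative:
  assumes f: "\<And>n. f n \<in> homset C (grade A n) (grade B n)"
    and eta: "eta A \<Zsemi> f 0 = eta B"
    and nabla: "\<And>n p. f n \<boxtimes> f p \<Zsemi> nabla B n p = nabla A n p \<Zsemi> f (n + p)"
  shows "Delta A n p \<Zsemi> f n \<boxtimes> f p = f (n + p) \<Zsemi> Delta B n p"
proof (induction "n + p" arbitrary: n p rule: less_induct)
  case less
  have t: "f n \<in> arr C" "src C (f n) = grade A n" "tgt C (f n) = grade B n" for n
    using f[of n] by (auto simp: homset_def)
  \<comment> \<open>A splitting with a part of degree zero only inserts \<open>eta\<close>, which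
    \<open>f 0\<close> preserves.\<close>
  have left: "Delta A 0 p \<Zsemi> f 0 \<boxtimes> f p = f (0 + p) \<Zsemi> Delta B 0 p" for p
    using A.tensor_seq_tensor[of "eta A" "f 0" "\<i>\<d> (grade A p)" "f p"]
      A.tensor_seq_tensor[of "\<i>\<d> \<I>" "eta B" "f p" "\<i>\<d> (grade B p)"]
    by (simp add: A.Delta_0_left B.Delta_0_left eta pair_simps t)
  have right: "Delta A n 0 \<Zsemi> f n \<boxtimes> f 0 = f (n + 0) \<Zsemi> Delta B n 0" for n
    using A.tensor_seq_tensor[of "\<i>\<d> (grade A n)" "f n" "eta A" "f 0"]
      A.tensor_seq_tensor[of "f n" "\<i>\<d> (grade B n)" "\<i>\<d> \<I>" "eta B"]
    by (simp add: A.Delta_0_right B.Delta_0_right eta pair_simps t)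
  show ?case
  proof (cases "n = 0 \<or> p = 0")
    case True
    then show ?thesis using left right by auto
  next
    case False
    define m where "m = n + p - 1"
    have m: "n + p = m + 1" "1 < n + p"
      using False by (auto simp: m_def)
    let ?I = "{(a, b, c, d). a + b = m \<and> c + d = 1 \<and> a + c = n \<and> b + d = p}"
    let ?X = "grade A m \<boxtimes>\<^sub>o grade A 1" and ?Y = "grade A n \<boxtimes>\<^sub>o grade A p"
      and ?X' = "grade B m \<boxtimes>\<^sub>o grade B 1" and ?Y' = "grade B n \<boxtimes>\<^sub>o grade B p"
    have o: "?X \<in> obj C" "?Y \<in> obj C" "?X' \<in> obj C" "?Y' \<in> obj C"
      by (simp_all add: pair_simps)
    have "A.exchange a b c d \<in> homset C ?X ?Y" if "(a, b, c, d) \<in> ?I" for a b c d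
      using that A.exchange_homset[of a b c d] by simp
    then have EA: "(\<lambda>(a, b, c, d). A.exchange a b c d) \<in> ?I \<rightarrow> homset C ?X ?Y"
      by auto
    have "B.exchange a b c d \<in> homset C ?X' ?Y'" if "(a, b, c, d) \<in> ?I" for a b c d
      using that B.exchange_homset[of a b c d] by simp
    then have EB: "(\<lambda>(a, b, c, d). B.exchange a b c d) \<in> ?I \<rightarrow> homset C ?X' ?Y'"
      by auto
    have E: "A.exchange a b c d \<Zsemi> f n \<boxtimes> f p = f m \<boxtimes> f 1 \<Zsemi> B.exchange a b c d"
      if "(a, b, c, d) \<in> ?I" for a b c d
    proof -
      have "A.exchange a b c d \<Zsemi> f (a + c) \<boxtimes> f (b + d) = f (a + b) \<boxtimes> f (c + d) \<Zsemi> B.exchange a b c d"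
        \<comment> \<open>The induction hypothesis is called in total degrees \<open>m\<close> and
          1; both lie below \<open>n + p\<close> because \<open>n\<close> and \<open>p\<close> are
          positive.\<close>
        by (rule exchange_natural[where f = f, OF f nabla less less]) (use that m in auto)
      then show ?thesis
        using that by simp
    qed
    have "nabla A m 1 \<Zsemi> (Delta A n p \<Zsemi> f n \<boxtimes> f p) = nabla A m 1 \<Zsemi> Delta A n p \<Zsemi> f n \<boxtimes> f p"
      using m(1) by (intro A.seq_assoc_arr[symmetric]) (simp_all add: pair_simps t del: One_nat_def)
    also have "\<dots> = finprod (hom_monoid C ?X ?Y) (\<lambda>(a, b, c, d). A.exchange a b c d) ?I \<Zsemi> f n \<boxtimes> f p"
      unfolding A.nabla_Delta_exchange[OF m(1)[symmetric]] ..
    also have "\<dots> = finprod (hom_monoid C ?X ?Y')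
        (\<lambda>i. (case i of (a, b, c, d) \<Rightarrow> A.exchange a b c d) \<Zsemi> f n \<boxtimes> f p) ?I"
      by (rule A.sum_seq[OF A.finite_exchange_indices EA A.tensor_homset[OF f f] o(1)])
    also have "\<dots> = finprod (hom_monoid C ?X ?Y')
        (\<lambda>i. f m \<boxtimes> f 1 \<Zsemi> (case i of (a, b, c, d) \<Rightarrow> B.exchange a b c d)) ?I"
    proof (rule comm_monoid.finprod_cong'[OF A.hom_comm_monoid[OF o(1,4)] refl])
      show "(\<lambda>i. f m \<boxtimes> f 1 \<Zsemi> (case i of (a, b, c, d) \<Rightarrow> B.exchange a b c d))
          \<in> ?I \<rightarrow> carrier (hom_monoid C ?X ?Y')"
        unfolding hom_monoid_def partial_object.simps
      proof (rule Pi_I)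
        fix i assume "i \<in> ?I"
        then show "f m \<boxtimes> f 1 \<Zsemi> (case i of (a, b, c, d) \<Rightarrow> B.exchange a b c d) \<in> homset C ?X ?Y'"
          by (rule A.seq_homset[OF A.tensor_homset[OF f f] funcset_mem[OF EB]])
      qed
    qed (use E in auto)
    also have "\<dots> = f m \<boxtimes> f 1 \<Zsemi> finprod (hom_monoid C ?X' ?Y') (\<lambda>(a, b, c, d). B.exchange a b c d) ?I"
      by (rule A.seq_sum[OF A.finite_exchange_indices EB A.tensor_homset[OF f f] o(4), symmetric])
    also have "\<dots> = f m \<boxtimes> f 1 \<Zsemi> (nabla B m 1 \<Zsemi> Delta B n p)"
      unfolding B.nabla_Delta_exchange[OF m(1)[symmetric]] ..
    also have "\<dots> = f m \<boxtimes> f 1 \<Zsemi> nabla B m 1 \<Zsemi> Delta B n p"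
      using m(1) by (intro A.seq_assoc_arr[symmetric]) (simp_all add: pair_simps t del: One_nat_def)
    also have "\<dots> = nabla A m 1 \<Zsemi> (f (n + p) \<Zsemi> Delta B n p)"
      unfolding nabla m(1)
      using m(1) by (intro A.seq_assoc_arr) (simp_all add: pair_simps t del: One_nat_def)
    finally show ?thesis
      by (rule A.nabla_cancel)
        (use m(1) in \<open>simp_all add: pair_simps t del: One_nat_def\<close>)
  qed
qed

text \<open>Multiplication by degree one generates all others: associativity builds the product with
  degree \<open>p + 1\<close> from products with degrees \<open>p\<close> and 1.\<close>

lemma nabla_1_imp_multiplicative:
  assumes f: "\<And>n. f n \<in> homset C (grade A n) (grade B n)"
    and eps: "f 0 \<Zsemi> eps B = eps A"
    and nabla_1: "\<And>n. f n \<boxtimes> f 1 \<Zsemi> nabla B n 1 = nabla A n 1 \<Zsemi> f (n + 1)"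
  shows "f n \<boxtimes> f p \<Zsemi> nabla B n p = nabla A n p \<Zsemi> f (n + p)"
proof (induction p)
  have t: "f n \<in> arr C" "src C (f n) = grade A n" "tgt C (f n) = grade B n" for n
    using f[of n] by (auto simp: homset_def)
  {
    case 0
    show ?case
      \<comment> \<open>Multiplication by degree zero is the counit, so the claim reduces to
        \<open>eps\<close>.\<close>
      using A.tensor_seq_tensor[of "f n" "\<i>\<d> (grade B n)" "f 0" "eps B"]
        A.tensor_seq_tensor[of "\<i>\<d> (grade A n)" "f n" "eps A" "\<i>\<d> \<I>"]
      by (simp add: A.nabla_0_right B.nabla_0_right eps pair_simps t)
  next
    case (Suc p)
    \<comment> \<open>Precomposition with the split epimorphism \<open>nabla A p 1\<close> in the
      second factor, to be cancelled at the end.\<close>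
    have "\<i>\<d> (grade A n) \<boxtimes> nabla A p 1 \<Zsemi> (nabla A n (p + 1) \<Zsemi> f (n + (p + 1)))
      = \<i>\<d> (grade A n) \<boxtimes> nabla A p 1 \<Zsemi> nabla A n (p + 1) \<Zsemi> f (n + p + 1)"
      by (simp add: pair_simps t add.assoc del: One_nat_def)
    also have "\<dots> = nabla A n p \<boxtimes> \<i>\<d> (grade A 1) \<Zsemi> (nabla A (n + p) 1 \<Zsemi> f (n + p + 1))"
      unfolding A.nabla_assoc[of n p 1, symmetric] by (simp add: pair_simps t add.assoc del: One_nat_def)
    also have "\<dots> = nabla A n p \<boxtimes> \<i>\<d> (grade A 1) \<Zsemi> f (n + p) \<boxtimes> f 1 \<Zsemi> nabla B (n + p) 1"
      unfolding nabla_1[symmetric] by (simp add: pair_simps t add.assoc del: One_nat_def)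
    also have "nabla A n p \<boxtimes> \<i>\<d> (grade A 1) \<Zsemi> f (n + p) \<boxtimes> f 1
      = (nabla A n p \<Zsemi> f (n + p)) \<boxtimes> (\<i>\<d> (grade A 1) \<Zsemi> f 1)"
      by (rule A.tensor_seq_tensor) (simp_all add: pair_simps t)
    also have "\<dots> = (f n \<boxtimes> f p \<Zsemi> nabla B n p) \<boxtimes> (f 1 \<Zsemi> \<i>\<d> (grade B 1))"
      unfolding Suc by (simp add: pair_simps t)
    also have "\<dots> = (f n \<boxtimes> f p) \<boxtimes> f 1 \<Zsemi> nabla B n p \<boxtimes> \<i>\<d> (grade B 1)"
      by (rule A.tensor_seq_tensor[symmetric]) (simp_all add: pair_simps t)
    also have "\<dots> \<Zsemi> nabla B (n + p) 1
      = f n \<boxtimes> (f p \<boxtimes> f 1) \<Zsemi> (nabla B n p \<boxtimes> \<i>\<d> (grade B 1) \<Zsemi> nabla B (n + p) 1)"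
      by (simp add: pair_simps t add.assoc del: One_nat_def)
    also have "\<dots> = f n \<boxtimes> (f p \<boxtimes> f 1) \<Zsemi> \<i>\<d> (grade B n) \<boxtimes> nabla B p 1 \<Zsemi> nabla B n (p + 1)"
      unfolding B.nabla_assoc[of n p 1] by (simp add: pair_simps t add.assoc del: One_nat_def)
    also have "f n \<boxtimes> (f p \<boxtimes> f 1) \<Zsemi> \<i>\<d> (grade B n) \<boxtimes> nabla B p 1
      = (f n \<Zsemi> \<i>\<d> (grade B n)) \<boxtimes> (f p \<boxtimes> f 1 \<Zsemi> nabla B p 1)"
      by (rule A.tensor_seq_tensor) (simp_all add: pair_simps t)
    \<comment> \<open>The assumption on degree one is used a second time, now to produce
      \<open>f (p + 1)\<close>.\<close>
    also have "\<dots> = (\<i>\<d> (grade A n) \<Zsemi> f n) \<boxtimes> (nabla A p 1 \<Zsemi> f (p + 1))"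
      unfolding nabla_1 by (simp add: pair_simps t)
    also have "\<dots> = \<i>\<d> (grade A n) \<boxtimes> nabla A p 1 \<Zsemi> f n \<boxtimes> f (p + 1)"
      by (rule A.tensor_seq_tensor[symmetric]) (simp_all add: pair_simps t)
    also have "\<dots> \<Zsemi> nabla B n (p + 1)
      = \<i>\<d> (grade A n) \<boxtimes> nabla A p 1 \<Zsemi> (f n \<boxtimes> f (p + 1) \<Zsemi> nabla B n (p + 1))"
      by (rule A.seq_assoc_arr) (simp_all add: pair_simps t)
    finally have "nabla A n (p + 1) \<Zsemi> f (n + (p + 1)) = f n \<boxtimes> f (p + 1) \<Zsemi> nabla B n (p + 1)"
      by (rule A.tensor_nabla_cancel) (simp_all add: pair_simps t)
    then show ?case
      by simp
  }
qed

section \<open>Extending a morphism from degree one to all degrees\<close>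

text \<open>The recursion is forced: for a morphism, the composite in the brackets is
  \<open>f (n + 1)\<close> followed by \<open>Delta B n 1\<close> and \<open>nabla B n 1\<close>,
  which is \<open>n + 1\<close> times \<open>f (n + 1)\<close>.\<close>

primrec extension :: "'m \<Rightarrow> nat \<Rightarrow> 'm" where
  "extension u 0 = eps A \<Zsemi> eta B"
| "extension u (Suc n) =
    (1 / of_nat (Suc n)) \<star> (Delta A n 1 \<Zsemi> extension u n \<boxtimes> u \<Zsemi> nabla B n 1)"

lemma extension_homset:
  assumes "u \<in> homset C (grade A 1) (grade B 1)"
  shows "extension u n \<in> homset C (grade A n) (grade B n)"
proof (induction n)
  case (Suc n)
  have "Delta A n 1 \<Zsemi> extension u n \<boxtimes> u \<Zsemi> nabla B n 1 \<in> homset C (grade A (Suc n)) (grade B (Suc n))"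
    using Suc assms by (simp add: pair_simps)
  then show ?case
    using A.scale_homset by simp
qed (simp add: pair_simps)

text \<open>The recursion with its denominator cleared. Later arguments about general degrees unfold
  \<open>extension\<close> only in this form.\<close>

lemma extension_Suc:
  assumes "u \<in> homset C (grade A 1) (grade B 1)"
  shows "Delta A n 1 \<Zsemi> extension u n \<boxtimes> u \<Zsemi> nabla B n 1 = of_nat (n + 1) \<star> extension u (n + 1)"
proof -
  have "Delta A n 1 \<Zsemi> extension u n \<boxtimes> u \<Zsemi> nabla B n 1 \<in> arr C"
    using extension_homset[OF assms, of n] assms by (simp add: pair_simps)
  then show ?thesis
    using A.scale_scale[of "of_nat (n + 1)" "1 / of_nat (n + 1)"] A.one_scale by simp
qed

text \<open>The unit inserted by \<open>Delta A 0 1\<close> becomes \<open>eta B\<close> under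
  \<open>extension u 0\<close> and is deleted by \<open>nabla B 0 1\<close>; the scalar is
  1.\<close>

lemma extension_1:
  assumes u: "u \<in> homset C (grade A 1) (grade B 1)"
  shows "extension u 1 = u"
proof -
  have "(eta A \<Zsemi> (eps A \<Zsemi> eta B)) \<boxtimes> (\<i>\<d> (grade A 1) \<Zsemi> u)
      = eta A \<boxtimes> \<i>\<d> (grade A 1) \<Zsemi> (eps A \<Zsemi> eta B) \<boxtimes> u"
    using u by (intro A.tensor_seq_tensor[symmetric]) (simp_all add: pair_simps)
  moreover have "eta A \<Zsemi> (eps A \<Zsemi> eta B) = eta B"
    using A.seq_assoc[OF A.eta_homset A.eps_homset B.eta_homset]
    by (simp add: A.eta_eps pair_simps)
  ultimately have "Delta A 0 1 \<Zsemi> extension u 0 \<boxtimes> u = eta B \<boxtimes> u"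
    using u by (simp add: A.Delta_0_left pair_simps)
  moreover have "eta B \<boxtimes> u \<Zsemi> nabla B 0 1 = (eta B \<Zsemi> eps B) \<boxtimes> (u \<Zsemi> \<i>\<d> (grade B 1))"
    unfolding B.nabla_0_left using u by (intro A.tensor_seq_tensor) (simp_all add: pair_simps)
  ultimately show ?thesis
    using u by (simp add: B.eta_eps A.one_scale pair_simps)
qed

lemma extension_nabla_1:
  assumes u: "u \<in> homset C (grade A 1) (grade B 1)"
  shows "extension u n \<boxtimes> u \<Zsemi> nabla B n 1 = nabla A n 1 \<Zsemi> extension u (n + 1)"
proof (induction n)
  have t: "extension u n \<in> arr C" "src C (extension u n) = grade A n"
    "tgt C (extension u n) = grade B n" for n
    using extension_homset[OF u, of n] by (auto simp: homset_def)
  have tu: "u \<in> arr C" "src C u = grade A 1" "tgt C u = grade B 1"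
    using u by (auto simp: homset_def)
  note simps = pair_simps t tu
  \<comment> \<open>Multiplying by \<open>n + 1\<close> makes the recursion expose
    \<open>nabla\<close> followed by \<open>Delta\<close>, to which the bialgebra axiom
    applies.\<close>
  have expand: "of_nat (n + 1) \<star> (nabla A n 1 \<Zsemi> extension u (n + 1))
    = nabla A n 1 \<Zsemi> Delta A n 1 \<Zsemi> (extension u n \<boxtimes> u \<Zsemi> nabla B n 1)" for n
  proof -
    have "of_nat (n + 1) \<star> (nabla A n 1 \<Zsemi> extension u (n + 1))
      = nabla A n 1 \<Zsemi> (of_nat (n + 1) \<star> extension u (n + 1))"
      by (rule A.seq_scale[OF _ A.nabla_homset extension_homset[OF u], symmetric]) simp
    also have "\<dots> = nabla A n 1 \<Zsemi> (Delta A n 1 \<Zsemi> extension u n \<boxtimes> u \<Zsemi> nabla B n 1)"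
      unfolding extension_Suc[OF u] ..
    finally show ?thesis
      by (simp add: simps del: extension.simps One_nat_def)
  qed
  {
    case 0
    show ?case
      using expand[of 0] unfolding A.nabla_Delta_0
      by (simp add: A.one_scale simps del: extension.simps One_nat_def)
  next
    case (Suc k)
    let ?f = "extension u"
    let ?D = "Delta A k 1 \<boxtimes> \<i>\<d> (grade A 1)"
      and ?G = "\<i>\<d> (grade A k) \<boxtimes> \<gamma> (grade A 1) (grade A 1)"
      and ?G' = "\<i>\<d> (grade B k) \<boxtimes> \<gamma> (grade B 1) (grade B 1)"
      and ?N = "nabla A k 1 \<boxtimes> \<i>\<d> (grade A 1)" and ?N' = "nabla B k 1 \<boxtimes> \<i>\<d> (grade B 1)"
      and ?h = "?f (k + 1) \<boxtimes> u \<Zsemi> nabla B (k + 1) 1"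
    \<comment> \<open>The induction hypothesis splits \<open>?f (k + 1)\<close> so that two equal
      factors \<open>u\<close> stand side by side, and the symmetry can slide past them.\<close>
    have N: "?N \<Zsemi> ?f (k + 1) \<boxtimes> u = ?f k \<boxtimes> (u \<boxtimes> u) \<Zsemi> ?N'"
    proof -
      have "?N \<Zsemi> ?f (k + 1) \<boxtimes> u = (nabla A k 1 \<Zsemi> ?f (k + 1)) \<boxtimes> (\<i>\<d> (grade A 1) \<Zsemi> u)"
        by (rule A.tensor_seq_tensor) (simp_all add: simps del: extension.simps One_nat_def)
      also have "\<dots> = (?f k \<boxtimes> u \<Zsemi> nabla B k 1) \<boxtimes> (u \<Zsemi> \<i>\<d> (grade B 1))"
        unfolding Suc by (simp add: simps del: extension.simps One_nat_def)
      also have "\<dots> = (?f k \<boxtimes> u) \<boxtimes> u \<Zsemi> ?N'"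
        by (rule A.tensor_seq_tensor[symmetric]) (simp_all add: simps del: extension.simps One_nat_def)
      finally show ?thesis
        by (simp add: simps del: extension.simps One_nat_def)
    qed
    have G: "?G \<Zsemi> ?f k \<boxtimes> (u \<boxtimes> u) = ?f k \<boxtimes> (u \<boxtimes> u) \<Zsemi> ?G'"
    proof -
      have "?G \<Zsemi> ?f k \<boxtimes> (u \<boxtimes> u) = (\<i>\<d> (grade A k) \<Zsemi> ?f k) \<boxtimes> (\<gamma> (grade A 1) (grade A 1) \<Zsemi> u \<boxtimes> u)"
        by (rule A.tensor_seq_tensor) (simp_all add: simps del: extension.simps One_nat_def)
      also have "\<dots> = (?f k \<Zsemi> \<i>\<d> (grade B k)) \<boxtimes> (u \<boxtimes> u \<Zsemi> \<gamma> (grade B 1) (grade B 1))"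
        unfolding A.symm_natural[OF u u] by (simp add: simps del: extension.simps One_nat_def)
      also have "\<dots> = ?f k \<boxtimes> (u \<boxtimes> u) \<Zsemi> ?G'"
        by (rule A.tensor_seq_tensor[symmetric]) (simp_all add: simps del: extension.simps One_nat_def)
      finally show ?thesis .
    qed
    \<comment> \<open>Without the symmetry, the left block is the recursion for
      \<open>?f (k + 1)\<close>; this is the source of the scalar \<open>k + 1\<close>.\<close>
    have D: "?D \<Zsemi> ?f k \<boxtimes> (u \<boxtimes> u) \<Zsemi> ?N' = of_nat (k + 1) \<star> (?f (k + 1) \<boxtimes> u)"
    proof -
      have "?D \<Zsemi> (?f k \<boxtimes> u) \<boxtimes> u = (Delta A k 1 \<Zsemi> ?f k \<boxtimes> u) \<boxtimes> (\<i>\<d> (grade A 1) \<Zsemi> u)"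
        by (rule A.tensor_seq_tensor) (simp_all add: simps del: extension.simps One_nat_def)
      then have "?D \<Zsemi> ?f k \<boxtimes> (u \<boxtimes> u) = (Delta A k 1 \<Zsemi> ?f k \<boxtimes> u) \<boxtimes> u"
        by (simp add: simps del: extension.simps One_nat_def)
      moreover have "(Delta A k 1 \<Zsemi> ?f k \<boxtimes> u) \<boxtimes> u \<Zsemi> ?N'
          = (Delta A k 1 \<Zsemi> ?f k \<boxtimes> u \<Zsemi> nabla B k 1) \<boxtimes> (u \<Zsemi> \<i>\<d> (grade B 1))"
        by (rule A.tensor_seq_tensor) (simp_all add: simps del: extension.simps One_nat_def)
      moreover have "u \<Zsemi> \<i>\<d> (grade B 1) = u"
        by (rule A.seq_ident[OF u])
      moreover have "(of_nat (k + 1) \<star> ?f (k + 1)) \<boxtimes> u = of_nat (k + 1) \<star> (?f (k + 1) \<boxtimes> u)"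
        by (rule A.scale_tensor[OF _ extension_homset[OF u] u]) simp
      ultimately show ?thesis
        unfolding extension_Suc[OF u] by simp
    qed
    have "A.exchange k 1 1 0 \<Zsemi> ?h = ?D \<Zsemi> ?G \<Zsemi> (?N \<Zsemi> ?f (k + 1) \<boxtimes> u) \<Zsemi> nabla B (k + 1) 1"
      unfolding A.exchange_1 by (simp add: simps del: extension.simps One_nat_def)
    also have "\<dots> = ?D \<Zsemi> (?G \<Zsemi> ?f k \<boxtimes> (u \<boxtimes> u)) \<Zsemi> (?N' \<Zsemi> nabla B (k + 1) 1)"
      unfolding N by (simp add: simps del: extension.simps One_nat_def)
    also have "\<dots> = ?D \<Zsemi> ?f k \<boxtimes> (u \<boxtimes> u) \<Zsemi> (?G' \<Zsemi> ?N' \<Zsemi> nabla B (k + 1) 1)"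
      unfolding G by (simp add: simps del: extension.simps One_nat_def)
    \<comment> \<open>The symmetry now sits on the side of \<open>B\<close>, directly before two
      multiplications by degree one, which absorb it.\<close>
    also have "\<dots> = (?D \<Zsemi> ?f k \<boxtimes> (u \<boxtimes> u) \<Zsemi> ?N') \<Zsemi> nabla B (k + 1) 1"
      unfolding B.nabla_swap by (simp add: simps del: extension.simps One_nat_def)
    also have "\<dots> = of_nat (k + 1) \<star> ?h"
      unfolding D
      by (rule A.scale_seq[OF _ A.tensor_homset[OF extension_homset[OF u] u] B.nabla_homset]) simp
    finally have T: "A.exchange k 1 1 0 \<Zsemi> ?h = of_nat (k + 1) \<star> ?h" .
    have h: "?h \<in> homset C (grade A (k + 1) \<boxtimes>\<^sub>o grade A 1) (grade B (k + 1 + 1))"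
      by (simp add: simps del: extension.simps One_nat_def)
    have e: "A.exchange k 1 1 0
        \<in> homset C (grade A (k + 1) \<boxtimes>\<^sub>o grade A 1) (grade A (k + 1) \<boxtimes>\<^sub>o grade A 1)"
      using A.exchange_homset[of k 1 1 0] by simp
    \<comment> \<open>The identity summand contributes \<open>?h\<close> once and the swap summand
      \<open>k + 1\<close> times; the total matches the factor on the left and cancels.\<close>
    have "of_nat (k + 1 + 1) \<star> (nabla A (k + 1) 1 \<Zsemi> ?f (k + 1 + 1)) = ?h \<boxplus> of_nat (k + 1) \<star> ?h"
      unfolding expand A.nabla_Delta_Suc T[symmetric]
      using A.add_seq[OF A.ident_homset e h] A.ident_seq[OF h]
      by (simp add: A.tensor_obj A.grade_obj del: extension.simps One_nat_def)
    also have "\<dots> = of_nat (k + 1 + 1) \<star> ?h"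
      using h A.add_scale[of 1 "of_nat (k + 1)" ?h] A.one_scale[of ?h]
      by (simp add: homset_def add.commute del: extension.simps One_nat_def)
    finally have "nabla A (k + 1) 1 \<Zsemi> ?f (k + 1 + 1) = ?h"
      by (rule A.scale_cancel) (use h in \<open>simp_all add: simps del: extension.simps One_nat_def\<close>)
    then show ?case
      by simp
  }
qed

lemma extension_hom:
  assumes u: "u \<in> homset C (grade A 1) (grade B 1)"
  shows "binomial_bimonoid_hom C A B (extension u)"
proof -
  note f = extension_homset[OF u]
  have eta: "eta A \<Zsemi> extension u 0 = eta B"
    using A.seq_assoc[OF A.eta_homset A.eps_homset B.eta_homset]
    by (simp add: A.eta_eps pair_simps)
  have eps: "extension u 0 \<Zsemi> eps B = eps A"
    by (simp add: B.eta_eps pair_simps)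
  \<comment> \<open>The general lemma refers to the component in degree one,
    \<open>extension_nabla_1\<close> to \<open>u\<close>; \<open>extension_1\<close> identifies
    them.\<close>
  have nabla: "extension u n \<boxtimes> extension u p \<Zsemi> nabla B n p = nabla A n p \<Zsemi> extension u (n + p)" for n p
    using nabla_1_imp_multiplicative[OF f eps] extension_nabla_1[OF u]
    unfolding extension_1[OF u] by blast
  show ?thesis
    unfolding binomial_bimonoid_hom_def
    using f eta eps nabla multiplicative_imp_comultiplicative[OF f eta nabla] by blast
qed

end

section \<open>Uniqueness and the resulting isomorphism\<close>

text \<open>Degree zero is fixed by \<open>eta A\<close>, which is invertible, and each further
  degree by the split epimorphism \<open>nabla A n 1\<close>. Endomorphisms suffice, since the lemma
  is applied to the two round trips.\<close>

lemma (in binomial_bimonoid) hom_eq_identI: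
  assumes f: "binomial_bimonoid_hom C A A f" and "f 1 = \<i>\<d> (grade A 1)"
  shows "f n = \<i>\<d> (grade A n)"
proof (induction n)
  case 0
  have "f 0 = eps A \<Zsemi> eta A \<Zsemi> f 0"
    unfolding eps_eta
    by (rule ident_seq[symmetric]) (use f in \<open>auto simp: binomial_bimonoid_hom_def\<close>)
  also have "\<dots> = eps A \<Zsemi> (eta A \<Zsemi> f 0)"
    using f by (intro seq_assoc[OF eps_homset eta_homset]) (auto simp: binomial_bimonoid_hom_def)
  finally show ?case
    using f by (simp add: binomial_bimonoid_hom_def eps_eta)
next
  case (Suc n)
  have "nabla A n 1 \<Zsemi> f (n + 1) = f n \<boxtimes> f 1 \<Zsemi> nabla A n 1"
    using f by (simp add: binomial_bimonoid_hom_def)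
  also have "\<dots> = nabla A n 1 \<Zsemi> \<i>\<d> (grade A (n + 1))"
    unfolding Suc assms(2) by (simp add: bimonoid_simps)
  finally have "f (n + 1) = \<i>\<d> (grade A (n + 1))"
    by (rule nabla_cancel) (use f in \<open>auto simp: binomial_bimonoid_hom_def ident_homset grade_obj\<close>)
  then show ?case
    by simp
qed

theorem proposition59:
  fixes C :: "('o, 'm, 'z) linear_symmetric_monoidal_category_scheme"
    and A B :: "('o, 'm) graded_bimonoid"
  assumes "nonneg_rat_linear_smc C"
    and "binomial_bimonoid C A"
    and "binomial_bimonoid C B"
    and "isomorphic C (grade A 1) (grade B 1)"
  shows "isomorphic (binomial_bimonoids C) A B"
proof -
  interpret binomial_bimonoid_pair C A B
    using assms(2,3) by (simp add: binomial_bimonoid_pair_def)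
  interpret inverse: binomial_bimonoid_pair C B A
    using assms(2,3) by (simp add: binomial_bimonoid_pair_def)
  obtain u v where u: "u \<in> homset C (grade A 1) (grade B 1)"
    and v: "v \<in> homset C (grade B 1) (grade A 1)"
    and uv: "u \<Zsemi>\<^bsub>C\<^esub> v = \<i>\<d>\<^bsub>C\<^esub> (grade A 1)" and vu: "v \<Zsemi>\<^bsub>C\<^esub> u = \<i>\<d>\<^bsub>C\<^esub> (grade B 1)"
    using assms(4) by (auto simp: isomorphic_def)
  let ?f = "extension u" and ?g = "inverse.extension v"
  note f = extension_hom[OF u] and g = inverse.extension_hom[OF v]
  \<comment> \<open>The composite of the two extensions is an endomorphism of \<open>A\<close> whose
    component in degree one is \<open>u\<close> followed by \<open>v\<close>, the identity.\<close>
  have fg: "?f n \<Zsemi>\<^bsub>C\<^esub> ?g n = \<i>\<d>\<^bsub>C\<^esub> (grade A n)" for n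
    using A.hom_eq_identI[OF A.binomial_bimonoid_hom_seq[OF assms(2,3,2) f g]]
    unfolding extension_1[OF u] inverse.extension_1[OF v] using uv by blast
  have gf: "?g n \<Zsemi>\<^bsub>C\<^esub> ?f n = \<i>\<d>\<^bsub>C\<^esub> (grade B n)" for n
    using B.hom_eq_identI[OF A.binomial_bimonoid_hom_seq[OF assms(3,2,3) g f]]
    unfolding extension_1[OF u] inverse.extension_1[OF v] using vu by blast
  show ?thesis
    unfolding isomorphic_def
  proof (intro conjI bexI)
    show "(A, B, ?f) \<in> homset (binomial_bimonoids C) A B"
      "(B, A, ?g) \<in> homset (binomial_bimonoids C) B A"
      using f g assms by (auto simp: binomial_bimonoids_def homset_def)
  qed (use assms fg gf in \<open>auto simp: binomial_bimonoids_def\<close>)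
qed

end
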